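(* Let $(p_n)_{n\ge2}$ and $(q_n)_{n\ge2}$ be real sequences with $q_n\in(0,1)$, $p_n\in(q_n,1]$, $\lim_{n\to\infty}p_n=a$ for some real $a$, $\lim_{n\to\infty}q_n=1$, $\lim_{n\to\infty}p_n^n=1$, $\lim_{n\to\infty}q_n^n=1$, and such that for every $n\ge 2$, $$p_nq_n([n]_{p_n,q_n}-1)>p_n^{n}(p_n-q_n).$$ Let $L^*_n(f;p_n;q_n;x)$ be the King type modified $(p,q)$-Lupaş Bernstein operators defined in the context. For $n\ge2$ and $x\in[0,1]$, writing $[m]=[m]_{p_n,q_n}$, put $$\delta_n(x)=\sqrt{2x^2+x\left(\frac{p_n^n+x^2[n](p_n-q_n)}{2(p_n^{n-1}q_n-p_n^n+q_n^2[n-1])}-\frac{\sqrt{p_n^{2n}+x^4[n]^2(p_n-q_n)^2+2x^2[n]\left(2p_nq_n([n]-1)-p_n^n(p_n-q_n)\right)}}{2(p_n^{n-1}q_n-p_n^n+q_n^2[n-1])}\right)}.$$ Then for every $n\ge2$, every $f\in C[0,1]$ and every $x\in[0,1]$ with $\delta_n(x)>0$, $$|L^*_n(f;p_n;q_n;x)-f(x)|\le 2\,w(f;\delta_n(x)).$$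
   Context: For $n\in\mathbb N$, $[n]_{p,q}=p^{n-1}+p^{n-2}q+\dots+pq^{n-2}+q^{n-1}$, $[0]_{p,q}=0$, $[n]_{p,q}!=[1]_{p,q}[2]_{p,q}\cdots[n]_{p,q}$, $[0]_{p,q}!=1$, and $\binom{n}{k}_{p,q}=\frac{[n]_{p,q}!}{[k]_{p,q}!\,[n-k]_{p,q}!}$ for $0\le k\le n$. For $n\ge2$ and $0<q<p\le1$ with $pq([n]_{p,q}-1)>p^n(p-q)$, writing $[m]=[m]_{p,q}$, put for $x\in[0,1]$ $$r_n(x)=\frac{-\left(p^n+x^2[n](p-q)\right)+\sqrt{p^{2n}+x^4[n]^2(p-q)^2+2x^2[n]\left(2pq([n]-1)-p^n(p-q)\right)}}{2\left(p^{n-1}q-p^n+q^2[n-1]\right)},$$ which satisfies $0\le r_n(x)\le 1$. For $f\in C[0,1]$ and $x\in[0,1]$, $$L^*_n(f;p;q;x)=\sum_{k=0}^n \frac{f\!\left(\frac{p^{n-k}[k]_{p,q}}{[n]_{p,q}}\right)\binom{n}{k}_{p,q}p^{\frac{(n-k)(n-k-1)}2}q^{\frac{k(k-1)}2}r_n(x)^k(1-r_n(x))^{n-k}}{\prod_{j=0}^{n-1}\{p^{j}(1-r_n(x))+q^{j}r_n(x)\}}.$$ When $p=p_n$, $q=q_n$, the function $r_n$ is formed with $p_n,q_n$. The modulus of continuity of $f\in C[0,1]$ is $w(f;\delta)=\sup\{|f(t)-f(x)|: x,t\in[0,1],\ |t-x|<\delta\}$ for $\delta>0$. *)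

theory Defs
  imports "HOL-Analysis.Analysis"
begin

definition pq_int :: "real \<Rightarrow> real \<Rightarrow> nat \<Rightarrow> real" where
  "pq_int p q n = (\<Sum>i<n. p ^ (n - 1 - i) * q ^ i)"

definition pq_fact :: "real \<Rightarrow> real \<Rightarrow> nat \<Rightarrow> real" where
  "pq_fact p q n = (\<Prod>i=1..n. pq_int p q i)"

text \<open>Only used for \<open>k \<le> n\<close>.\<close>
definition pq_binomial :: "real \<Rightarrow> real \<Rightarrow> nat \<Rightarrow> nat \<Rightarrow> real" where
  "pq_binomial p q n k = pq_fact p q n / (pq_fact p q k * pq_fact p q (n - k))"

definition king_r :: "real \<Rightarrow> real \<Rightarrow> nat \<Rightarrow> real \<Rightarrow> real" where
  "king_r p q n x =
     (- (p ^ n + x\<^sup>2 * pq_int p q n * (p - q))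
      + sqrt (p ^ (2 * n) + x ^ 4 * (pq_int p q n)\<^sup>2 * (p - q)\<^sup>2
              + 2 * x\<^sup>2 * pq_int p q n * (2 * p * q * (pq_int p q n - 1) - p ^ n * (p - q))))
     / (2 * (p ^ (n - 1) * q - p ^ n + q\<^sup>2 * pq_int p q (n - 1)))"

text \<open>The natural-number divisions by 2 are exact, and for \<open>m = 0\<close> the truncated
  product \<open>m * (m - 1)\<close> has the intended value 0.\<close>
definition king_lupas :: "real \<Rightarrow> real \<Rightarrow> nat \<Rightarrow> (real \<Rightarrow> real) \<Rightarrow> real \<Rightarrow> real" where
  "king_lupas p q n f x =
     (\<Sum>k\<le>n. f (p ^ (n - k) * pq_int p q k / pq_int p q n) * pq_binomial p q n k
              * p ^ ((n - k) * (n - k - 1) div 2) * q ^ (k * (k - 1) div 2)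
              * king_r p q n x ^ k * (1 - king_r p q n x) ^ (n - k)
            / (\<Prod>j<n. p ^ j * (1 - king_r p q n x) + q ^ j * king_r p q n x))"

text \<open>An element of $C[0,1]$ is represented by a total function that is continuous on
  \<open>{0..1}\<close>; only its values there matter. For such functions and \<open>\<delta> > 0\<close> the set below
  is nonempty and bounded, so the real \<open>Sup\<close> is the true supremum.\<close>
definition modulus_cont :: "(real \<Rightarrow> real) \<Rightarrow> real \<Rightarrow> real" where
  "modulus_cont f \<delta> = Sup {\<bar>f t - f x\<bar> | t x. x \<in> {0..1} \<and> t \<in> {0..1} \<and> \<bar>t - x\<bar> < \<delta>}"

definition king_delta :: "real \<Rightarrow> real \<Rightarrow> nat \<Rightarrow> real \<Rightarrow> real" where
  "king_delta p q n x =
     sqrt (2 * x\<^sup>2 + x *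
       ((p ^ n + x\<^sup>2 * pq_int p q n * (p - q))
          / (2 * (p ^ (n - 1) * q - p ^ n + q\<^sup>2 * pq_int p q (n - 1)))
        - sqrt (p ^ (2 * n) + x ^ 4 * (pq_int p q n)\<^sup>2 * (p - q)\<^sup>2
                + 2 * x\<^sup>2 * pq_int p q n * (2 * p * q * (pq_int p q n - 1) - p ^ n * (p - q)))
          / (2 * (p ^ (n - 1) * q - p ^ n + q\<^sup>2 * pq_int p q (n - 1)))))"

end

theory Submission
  imports Defs
begin

text \<open>
  The weights of the Lupas operator with parameter \<open>r \<in> [0,1]\<close> form a probability distribution
  with mean \<open>r\<close> and an explicit second moment. All these facts come from splitting a weight of
  level \<open>n + 1\<close> along \<open>[n + 1] = p\<^bsup>n+1-k\<^esup>[k] + q\<^bsup>k\<^esup>[n + 1 - k]\<close>, each part being a weight of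
  level \<open>n\<close> at the rescaled arguments \<open>(p a, q b)\<close>.

  The paper chooses \<open>r\<^sub>n(x)\<close> as the root of the quadratic equation saying that the second moment
  is \<open>x\<^sup>2\<close>. With the discriminant as printed this is exact only for \<open>p = 1\<close>; in general the
  discriminant is too small by \<open>4 x\<^sup>2 [n] p q (1 - p\<^bsup>n-1\<^esup>)\<close>, so that the second moment is only
  \<open>\<le> x\<^sup>2\<close>. That is the direction needed: the variance about \<open>x\<close> is at most
  \<open>2 x\<^sup>2 - 2 x r\<^sub>n(x) \<le> 2 x\<^sup>2 - x r\<^sub>n(x) = \<delta>\<^sub>n(x)\<^sup>2\<close>, and the Shisha--Mond argument concludes.
\<close>

section \<open>Moments of the Lupas weights\<close>

lemma pq_int_0 [simp]: "pq_int p q 0 = 0"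
  by (simp add: pq_int_def)

lemma pq_int_Suc: "pq_int p q (Suc n) = p ^ n + q * pq_int p q n"
  by (simp add: pq_int_def sum.lessThan_Suc_shift sum_distrib_left mult_ac del: sum.lessThan_Suc)

lemma pq_int_pos: "\<lbrakk>p > 0; q > 0; n > 0\<rbrakk> \<Longrightarrow> pq_int p q n > 0"
  by (auto simp: pq_int_def intro!: sum_pos)

lemma pq_int_nonneg: "\<lbrakk>p > 0; q > 0\<rbrakk> \<Longrightarrow> pq_int p q n \<ge> 0"
  by (auto simp: pq_int_def intro!: sum_nonneg)

text \<open>Of the \<open>k + m\<close> summands, the first \<open>k\<close> share the factor
  \<open>p ^ m\<close> and the last \<open>m\<close> share \<open>q ^ k\<close>.\<close>

lemma pq_int_add: "pq_int p q (k + m) = p ^ m * pq_int p q k + q ^ k * pq_int p q m"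
  by (induction k) (simp_all add: pq_int_Suc power_add algebra_simps)

lemma pq_fact_Suc: "pq_fact p q (Suc n) = pq_fact p q n * pq_int p q (Suc n)"
  by (simp add: pq_fact_def)

lemma pq_fact_pos: "\<lbrakk>p > 0; q > 0\<rbrakk> \<Longrightarrow> pq_fact p q n > 0"
  by (auto simp: pq_fact_def intro!: prod_pos pq_int_pos)

text \<open>Increments of the triangular exponents supply powers of \<open>p\<close> or
  \<open>q\<close> that rescale \<open>a\<close> to \<open>p * a\<close> or \<open>b\<close> to
  \<open>q * b\<close>.\<close>

lemma triangle_Suc: "Suc m * (Suc m - 1) div 2 = m * (m - 1) div 2 + m"
proof -
  have "Suc m * (Suc m - 1) = m * (m - 1) + m * 2"
    by (cases m) auto
  then show ?thesis
    by simp
qed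

text \<open>Unnormalised, with independent \<open>a\<close> and \<open>b\<close> in place of
  \<open>1 - r\<close> and \<open>r\<close>: the recursion passes to \<open>(p * a, q * b)\<close>,
  which need not sum to 1.\<close>

definition lupas_weight :: "real \<Rightarrow> real \<Rightarrow> nat \<Rightarrow> nat \<Rightarrow> real \<Rightarrow> real \<Rightarrow> real" where
  "lupas_weight p q n k a b =
     pq_binomial p q n k * p ^ ((n - k) * (n - k - 1) div 2) * q ^ (k * (k - 1) div 2)
       * b ^ k * a ^ (n - k)"

definition lupas_node :: "real \<Rightarrow> real \<Rightarrow> nat \<Rightarrow> nat \<Rightarrow> real" where
  "lupas_node p q n k = p ^ (n - k) * pq_int p q k / pq_int p q n"

context
  fixes p q :: real
  assumes p_pos: "p > 0" and q_pos: "q > 0"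
begin

lemma pq_int_Suc_neq_0: "pq_int p q (Suc n) \<noteq> 0"
  using pq_int_pos[OF p_pos q_pos, of "Suc n"] by simp

lemma pq_fact_neq_0: "pq_fact p q n \<noteq> 0"
  using pq_fact_pos[OF p_pos q_pos, of n] by simp

lemma lupas_weight_nonneg:
  assumes "a \<ge> 0" "b \<ge> 0"
  shows "lupas_weight p q n k a b \<ge> 0"
  unfolding lupas_weight_def pq_binomial_def
  using assms p_pos q_pos by (simp add: less_imp_le[OF pq_fact_pos])

lemma lupas_node_0 [simp]: "lupas_node p q n 0 = 0"
  by (simp add: lupas_node_def)

lemma lupas_node_complement:
  assumes "k \<le> Suc n"
  shows "1 - lupas_node p q (Suc n) k = q ^ k * pq_int p q (Suc n - k) / pq_int p q (Suc n)"
  using pq_int_add[of p q k "Suc n - k"] assms pq_int_Suc_neq_0[of n]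
  by (simp add: lupas_node_def field_simps)

lemma lupas_node_bounds:
  assumes "k \<le> Suc n"
  shows "lupas_node p q (Suc n) k \<in> {0..1}"
proof -
  have "1 - lupas_node p q (Suc n) k \<ge> 0"
    unfolding lupas_node_complement[OF assms]
    by (intro divide_nonneg_nonneg mult_nonneg_nonneg) (use p_pos q_pos in \<open>auto intro: pq_int_nonneg\<close>)
  moreover have "lupas_node p q (Suc n) k \<ge> 0"
    unfolding lupas_node_def
    by (intro divide_nonneg_nonneg mult_nonneg_nonneg) (use p_pos q_pos in \<open>auto intro: pq_int_nonneg\<close>)
  ultimately show ?thesis
    by simp
qed

text \<open>The quotient of (p,q)-integers lowers the binomial; \<open>p ^ (n - k)\<close> from the
  node and \<open>q ^ k\<close> from the triangular exponent rescale \<open>a\<close> and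
  \<open>b\<close>.\<close>

lemma node_times_weight_Suc:
  assumes "k \<le> n"
  shows "lupas_node p q (Suc n) (Suc k) * lupas_weight p q (Suc n) (Suc k) a b
           = b * lupas_weight p q n k (p * a) (q * b)"
proof -
  have binomial: "pq_binomial p q n k
      = pq_int p q (Suc k) / pq_int p q (Suc n) * pq_binomial p q (Suc n) (Suc k)"
    using pq_int_Suc_neq_0 pq_fact_neq_0
    by (simp add: pq_binomial_def pq_fact_Suc)
  show ?thesis
    unfolding lupas_node_def lupas_weight_def binomial triangle_Suc diff_Suc_Suc
      power_add power_mult_distrib power_Suc
    by (simp add: mult_ac)
qed

text \<open>Mirror image: here \<open>q ^ k\<close> comes from the complement and
  \<open>p ^ (n - k)\<close> from the triangular exponent.\<close>

lemma complement_times_weight_Suc: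
  assumes "k \<le> n"
  shows "(1 - lupas_node p q (Suc n) k) * lupas_weight p q (Suc n) k a b
           = a * lupas_weight p q n k (p * a) (q * b)"
proof -
  obtain m where n: "n = k + m"
    using assms le_Suc_ex by blast
  have binomial: "pq_binomial p q n k
      = pq_int p q (Suc m) / pq_int p q (Suc n) * pq_binomial p q (Suc n) k"
    using pq_int_Suc_neq_0 pq_fact_neq_0
    by (simp add: pq_binomial_def pq_fact_Suc n Suc_diff_le)
  have node: "1 - lupas_node p q (Suc n) k = q ^ k * (pq_int p q (Suc m) / pq_int p q (Suc n))"
    using lupas_node_complement[of k n] by (simp add: n Suc_diff_le)
  have diffs: "Suc n - k = Suc m" "n - k = m"
    by (simp_all add: n)
  show ?thesis
    unfolding lupas_weight_def binomial node diffs triangle_Suc power_add power_mult_distrib power_Suc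
    by (simp add: mult_ac)
qed

text \<open>The term \<open>k = 0\<close> vanishes with its node. The free factor \<open>g\<close>
  serves the first moment (constant 1) and the second (another node).\<close>

lemma sum_node_times_weight:
  "(\<Sum>k\<le>Suc n. g k * (lupas_node p q (Suc n) k * lupas_weight p q (Suc n) k a b))
     = b * (\<Sum>k\<le>n. g (Suc k) * lupas_weight p q n k (p * a) (q * b))"
  by (subst sum.atMost_Suc_shift)
    (simp add: node_times_weight_Suc sum_distrib_left mult_ac)

lemma sum_lupas_weight_Suc:
  "(\<Sum>k\<le>Suc n. lupas_weight p q (Suc n) k a b)
     = (a + b) * (\<Sum>k\<le>n. lupas_weight p q n k (p * a) (q * b))"
proof -
  let ?t = "lupas_node p q (Suc n)" and ?w = "\<lambda>k. lupas_weight p q (Suc n) k a b"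
  have [simp]: "?t (Suc n) = 1"
    using pq_int_Suc_neq_0[of n] by (simp add: lupas_node_def)
  have "(\<Sum>k\<le>Suc n. ?w k) = (\<Sum>k\<le>Suc n. ?t k * ?w k) + (\<Sum>k\<le>Suc n. (1 - ?t k) * ?w k)"
    by (simp add: algebra_simps flip: sum.distrib)
  also have "(\<Sum>k\<le>Suc n. ?t k * ?w k) = b * (\<Sum>k\<le>n. lupas_weight p q n k (p * a) (q * b))"
    using sum_node_times_weight[of "\<lambda>_. 1" n a b] by (simp del: sum.atMost_Suc)
  \<comment> \<open>The top term drops out because its node is 1.\<close>
  also have "(\<Sum>k\<le>Suc n. (1 - ?t k) * ?w k) = (\<Sum>k\<le>n. (1 - ?t k) * ?w k)"
    by simp
  also have "\<dots> = a * (\<Sum>k\<le>n. lupas_weight p q n k (p * a) (q * b))"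
    by (simp add: complement_times_weight_Suc sum_distrib_left)
  finally show ?thesis
    by (simp add: algebra_simps)
qed

text \<open>The (p,q)-binomial theorem: each level peels off the factor \<open>a + b\<close>, and
  rescaling the arguments shifts the remaining factors by one index.\<close>

lemma sum_lupas_weight:
  "(\<Sum>k\<le>n. lupas_weight p q n k a b) = (\<Prod>j<n. p ^ j * a + q ^ j * b)"
proof (induction n arbitrary: a b)
  case 0
  then show ?case
    by (simp add: lupas_weight_def pq_binomial_def pq_fact_def)
next
  case (Suc n)
  show ?case
    unfolding sum_lupas_weight_Suc Suc
    by (simp add: prod.lessThan_Suc_shift mult_ac del: prod.lessThan_Suc)
qed

lemma first_moment_lupas_weight:
  "(\<Sum>k\<le>Suc n. lupas_node p q (Suc n) k * lupas_weight p q (Suc n) k a b)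
     = b * (\<Prod>j<n. p ^ Suc j * a + q ^ Suc j * b)"
  using sum_node_times_weight[of "\<lambda>_. 1" n a b] by (simp add: sum_lupas_weight mult_ac)

text \<open>One node factor lowers the level; the other is affine in the node of the lower level, so
  moments 0 and 1 there suffice.\<close>

lemma second_moment_lupas_weight:
  "pq_int p q (Suc (Suc n)) *
     (\<Sum>k\<le>Suc (Suc n). (lupas_node p q (Suc (Suc n)) k)\<^sup>2 * lupas_weight p q (Suc (Suc n)) k a b)
   = b * (p ^ Suc n * (p * a + q * b) + q\<^sup>2 * pq_int p q (Suc n) * b)
       * (\<Prod>j<n. p ^ Suc (Suc j) * a + q ^ Suc (Suc j) * b)"
proof -
  let ?N = "Suc (Suc n)" and ?w = "\<lambda>k. lupas_weight p q (Suc n) k (p * a) (q * b)"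
  let ?P = "\<Prod>j<n. p ^ Suc (Suc j) * a + q ^ Suc (Suc j) * b"
  \<comment> \<open>This is \<open>[k+1] = p^k + q [k]\<close> multiplied by
    \<open>p ^ (Suc n - k)\<close>.\<close>
  have node: "pq_int p q ?N * lupas_node p q ?N (Suc k)
      = p ^ Suc n + q * pq_int p q (Suc n) * lupas_node p q (Suc n) k" if "k \<le> Suc n" for k
  proof -
    have "p ^ (Suc n - k) * p ^ k = p ^ Suc n"
      using that by (simp only: flip: power_add) simp
    then show ?thesis
      using pq_int_Suc_neq_0[of n] pq_int_Suc_neq_0[of "Suc n"]
      unfolding lupas_node_def by (simp add: pq_int_Suc[of p q k] field_simps)
  qed
  have "pq_int p q ?N * (\<Sum>k\<le>?N. (lupas_node p q ?N k)\<^sup>2 * lupas_weight p q ?N k a b)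
      = pq_int p q ?N * (\<Sum>k\<le>?N. lupas_node p q ?N k *
          (lupas_node p q ?N k * lupas_weight p q ?N k a b))"
    by (simp only: power2_eq_square mult.assoc)
  also have "\<dots> = b * (\<Sum>k\<le>Suc n. (pq_int p q ?N * lupas_node p q ?N (Suc k)) * ?w k)"
    unfolding sum_node_times_weight by (simp only: sum_distrib_left mult_ac)
  also have "(\<Sum>k\<le>Suc n. (pq_int p q ?N * lupas_node p q ?N (Suc k)) * ?w k)
      = (\<Sum>k\<le>Suc n. p ^ Suc n * ?w k
          + q * pq_int p q (Suc n) * (lupas_node p q (Suc n) k * ?w k))"
    by (intro sum.cong refl) (simp only: node atMost_iff algebra_simps)
  also have "\<dots> = p ^ Suc n * (\<Sum>k\<le>Suc n. ?w k)
      + q * pq_int p q (Suc n) * (\<Sum>k\<le>Suc n. lupas_node p q (Suc n) k * ?w k)"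
    by (simp only: sum.distrib sum_distrib_left)
  also have "(\<Sum>k\<le>Suc n. ?w k) = (p * a + q * b) * ?P"
    unfolding sum_lupas_weight
    by (simp add: prod.lessThan_Suc_shift mult_ac del: prod.lessThan_Suc)
  also have "(\<Sum>k\<le>Suc n. lupas_node p q (Suc n) k * ?w k) = q * b * ?P"
    unfolding first_moment_lupas_weight by (simp add: mult_ac)
  finally show ?thesis
    by (simp add: algebra_simps power2_eq_square)
qed

end

section \<open>The King parameter\<close>

text \<open>Multiplied by \<open>p\<close>, the denominator is the gap in the hypothesis plus
  \<open>p * q * (1 - p ^ (n - 1))\<close>, which is nonnegative.\<close>

lemma king_r_denominator_pos:
  assumes "0 < q" "q < p" "p \<le> 1" "n \<ge> 1" "p * q * (pq_int p q n - 1) > p ^ n * (p - q)"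
  shows "p ^ (n - 1) * q - p ^ n + q\<^sup>2 * pq_int p q (n - 1) > 0"
proof -
  obtain m where n: "n = Suc m"
    using assms(4) by (cases n) auto
  let ?D = "p ^ (n - 1) * q - p ^ n + q\<^sup>2 * pq_int p q (n - 1)"
  have "p * ?D = p * q * pq_int p q n - p ^ n * p"
    by (simp add: n pq_int_Suc algebra_simps power2_eq_square)
  also have "\<dots> = (p * q * (pq_int p q n - 1) - p ^ n * (p - q)) + p * q * (1 - p ^ m)"
    by (simp add: n algebra_simps)
  also have "\<dots> > 0"
    using assms by (intro add_pos_nonneg mult_nonneg_nonneg) (auto simp: power_le_one)
  finally show ?thesis
    using assms by (simp add: zero_less_mult_iff)
qed

text \<open>The third claim says that the second moment of the weights with parameter \<open>r\<^sub>n(x)\<close> is at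
  most \<open>x\<^sup>2\<close>, cleared of denominators.\<close>

lemma king_r_properties:
  assumes "0 < q" "q < p" "p \<le> 1" "n \<ge> 1" "p * q * (pq_int p q n - 1) > p ^ n * (p - q)"
    and x: "x \<in> {0..1}"
  defines "r \<equiv> king_r p q n x"
  shows "0 \<le> r" "r \<le> 1"
    "p ^ (n - 1) * r * (p * (1 - r) + q * r) + q\<^sup>2 * pq_int p q (n - 1) * r\<^sup>2
       \<le> x\<^sup>2 * pq_int p q n * (p * (1 - r) + q * r)"
proof -
  obtain m where n: "n = Suc m"
    using assms(4) by (cases n) auto
  define N where "N = pq_int p q n"
  \<comment> \<open>Chosen so that \<open>r\<close> is the nonnegative root of
    \<open>D * (D * r^2 + A * r) = x^2 * N * C\<close>.\<close>
  define D where "D = p ^ (n - 1) * q - p ^ n + q\<^sup>2 * pq_int p q (n - 1)"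
  define A where "A = p ^ n + x\<^sup>2 * N * (p - q)"
  define C where "C = p * q * (N - 1) - p ^ n * (p - q)"
  have D: "D > 0"
    unfolding D_def by (rule king_r_denominator_pos) (use assms in auto)
  have N: "N > 0"
    using assms unfolding N_def by (intro pq_int_pos) auto
  have C: "C > 0"
    using assms by (simp add: C_def N_def)
  have A: "A > 0"
    unfolding A_def using assms N by (intro add_pos_nonneg) auto
  define S where "S = sqrt (A\<^sup>2 + 4 * x\<^sup>2 * N * C)"
  have S2: "S\<^sup>2 = A\<^sup>2 + 4 * x\<^sup>2 * N * C"
    using N C by (simp add: S_def)
  have "p ^ (2 * n) + x ^ 4 * N\<^sup>2 * (p - q)\<^sup>2
          + 2 * x\<^sup>2 * N * (2 * p * q * (N - 1) - p ^ n * (p - q)) = A\<^sup>2 + 4 * x\<^sup>2 * N * C"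
  proof -
    have "P\<^sup>2 + x ^ 4 * N\<^sup>2 * (p - q)\<^sup>2 + 2 * x\<^sup>2 * N * (2 * p * q * (N - 1) - P * (p - q))
        = (P + x\<^sup>2 * N * (p - q))\<^sup>2 + 4 * x\<^sup>2 * N * (p * q * (N - 1) - P * (p - q))" for P
      by algebra
    from this[of "p ^ n"] show ?thesis
      unfolding A_def C_def by (simp only: power_mult mult.commute[of 2 n])
  qed
  then have r: "r = (S - A) / (2 * D)"
    by (simp add: r_def king_r_def S_def D_def A_def flip: N_def)
  have "S \<ge> A"
    unfolding S_def by (rule real_le_rsqrt) (use N C in auto)
  then show r0: "0 \<le> r"
    using D by (simp add: r)
  have "4 * D * (D * r\<^sup>2 + A * r) = (2 * D * r + A)\<^sup>2 - A\<^sup>2"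
    by (simp add: algebra_simps power2_eq_square)
  also have "2 * D * r + A = S"
    using D by (simp add: r)
  also have "S\<^sup>2 - A\<^sup>2 = 4 * (x\<^sup>2 * N * C)"
    by (simp add: S2)
  finally have *: "D * (D * r\<^sup>2 + A * r) = x\<^sup>2 * N * C"
    by simp
  \<comment> \<open>With \<open>D * p\<close> in place of \<open>C\<close>, the root equation would
    make the second moment exactly \<open>x^2\<close>; \<open>C \<le> D * p\<close> weakens this to
    an upper bound.\<close>
  have "C = D * p - p * q * (1 - p ^ m)"
    unfolding C_def D_def N_def by (simp add: n pq_int_Suc algebra_simps power2_eq_square)
  also have "\<dots> \<le> D * p"
    using assms by (simp add: power_le_one)
  finally have "D * (D * r\<^sup>2 + A * r) \<le> D * (x\<^sup>2 * N * p)"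
    unfolding * using N mult_left_mono[of C "D * p" "x\<^sup>2 * N"] by (simp add: mult_ac)
  then have quad: "D * r\<^sup>2 + A * r \<le> x\<^sup>2 * N * p"
    using D by simp
  show "r \<le> 1"
  proof (rule ccontr)
    \<comment> \<open>The left side of \<open>quad\<close> increases in \<open>r\<close>, and
      already at 1 its value \<open>D + A\<close> is at least the right side.\<close>
    assume "\<not> r \<le> 1"
    then have "D * 1 + A * 1 < D * r\<^sup>2 + A * r"
      using D A by (intro add_strict_mono mult_strict_left_mono) (auto simp: one_less_power)
    moreover have "D + A - x\<^sup>2 * N * p = q * N * (1 - x\<^sup>2)"
      unfolding D_def A_def N_def by (simp add: n pq_int_Suc algebra_simps power2_eq_square)
    moreover have "q * N * (1 - x\<^sup>2) \<ge> 0"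
      using assms N x by (intro mult_nonneg_nonneg) (auto simp: power_le_one)
    ultimately show False
      using quad by simp
  qed
  show "p ^ (n - 1) * r * (p * (1 - r) + q * r) + q\<^sup>2 * pq_int p q (n - 1) * r\<^sup>2
       \<le> x\<^sup>2 * pq_int p q n * (p * (1 - r) + q * r)"
    \<comment> \<open>Collecting powers of \<open>r\<close> turns the claim into
      \<open>quad\<close>.\<close>
    using quad unfolding D_def A_def N_def[symmetric]
    by (simp add: n algebra_simps power2_eq_square)
qed

text \<open>The bracket multiplied by \<open>x\<close> in \<open>king_delta\<close> is the negative
  of \<open>king_r\<close>.\<close>

lemma king_delta_eq: "king_delta p q n x = sqrt (2 * x\<^sup>2 - x * king_r p q n x)"
  unfolding king_delta_def king_r_def
  by (simp add: diff_divide_distrib add_divide_distrib algebra_simps)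

section \<open>The modulus of continuity\<close>

lemma modulus_cont_upper:
  assumes f: "continuous_on {0..1} f" and "s \<in> {0..1}" "t \<in> {0..1}" "\<bar>t - s\<bar> < \<delta>"
  shows "\<bar>f t - f s\<bar> \<le> modulus_cont f \<delta>"
proof -
  have "bounded (f ` {0..1})"
    using f by (intro compact_imp_bounded compact_continuous_image) auto
  then obtain B where "\<forall>y\<in>f ` {0..1}. norm y \<le> B"
    unfolding bounded_iff by blast
  then have B: "\<And>u. u \<in> {0..1} \<Longrightarrow> \<bar>f u\<bar> \<le> B"
    by auto
  have "bdd_above {\<bar>f t - f x\<bar> | t x. x \<in> {0..1} \<and> t \<in> {0..1} \<and> \<bar>t - x\<bar> < \<delta>}"
  proof (rule bdd_aboveI[of _ "2 * B"])
    fix y assume "y \<in> {\<bar>f t - f x\<bar> | t x. x \<in> {0..1} \<and> t \<in> {0..1} \<and> \<bar>t - x\<bar> < \<delta>}"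
    then obtain t x where "y = \<bar>f t - f x\<bar>" "x \<in> {0..1}" "t \<in> {0..1}"
      by blast
    then show "y \<le> 2 * B"
      using B[of t] B[of x] by linarith
  qed
  then show ?thesis
    unfolding modulus_cont_def using assms by (intro cSup_upper) auto
qed

text \<open>Cut the segment from \<open>s\<close> to \<open>t\<close> into \<open>m\<close> equal
  pieces, each shorter than \<open>\<delta>\<close>, and add up the increments.\<close>

lemma modulus_cont_chain:
  assumes f: "continuous_on {0..1} f" and s: "s \<in> {0..1}" and t: "t \<in> {0..1}"
    and m: "m > 0" "\<bar>t - s\<bar> < real m * \<delta>"
  shows "\<bar>f t - f s\<bar> \<le> real m * modulus_cont f \<delta>"
proof -
  define c where "c i = s + real i / real m * (t - s)" for i
  have c: "c i \<in> {0..1}" if "i \<le> m" for i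
  proof -
    have "c i = (1 - real i / real m) *\<^sub>R s + (real i / real m) *\<^sub>R t"
      by (simp add: c_def algebra_simps diff_divide_distrib)
    also have "\<dots> \<in> {0..1}"
      by (rule convexD_alt) (use s t that m in \<open>auto simp: divide_simps\<close>)
    finally show ?thesis .
  qed
  have step: "\<bar>f (c (Suc i)) - f (c i)\<bar> \<le> modulus_cont f \<delta>" if "i < m" for i
  proof (rule modulus_cont_upper[OF f])
    have "c (Suc i) - c i = (t - s) / real m"
      by (simp add: c_def add_divide_distrib algebra_simps)
    then have "\<bar>c (Suc i) - c i\<bar> = \<bar>t - s\<bar> / real m"
      by simp
    also have "\<dots> < \<delta>"
      using m by (simp add: pos_divide_less_eq mult.commute)
    finally show "\<bar>c (Suc i) - c i\<bar> < \<delta>" .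
  qed (use c that in auto)
  have "f t - f s = f (c m) - f (c 0)"
    using m by (simp add: c_def)
  also have "\<dots> = (\<Sum>i<m. f (c (Suc i)) - f (c i))"
    by (rule sum_lessThan_telescope[of "\<lambda>i. f (c i)", symmetric])
  also have "\<bar>\<dots>\<bar> \<le> (\<Sum>i<m. modulus_cont f \<delta>)"
    by (rule order_trans[OF sum_abs]) (intro sum_mono, use step in auto)
  finally show ?thesis
    by simp
qed

lemma modulus_cont_nonneg:
  assumes "continuous_on {0..1} f" "\<delta> > 0"
  shows "modulus_cont f \<delta> \<ge> 0"
  using modulus_cont_upper[OF assms(1), of 0 0 \<delta>] assms(2) by simp

text \<open>A bound quadratic in \<open>t - s\<close> leaves only the variance to be estimated after
  averaging.\<close>

lemma modulus_cont_quadratic: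
  assumes f: "continuous_on {0..1} f" and s: "s \<in> {0..1}" and t: "t \<in> {0..1}" and d: "\<delta> > 0"
  shows "\<bar>f t - f s\<bar> \<le> (1 + (t - s)\<^sup>2 / \<delta>\<^sup>2) * modulus_cont f \<delta>"
proof -
  define l where "l = \<bar>t - s\<bar> / \<delta>"
  \<comment> \<open>Floor plus one keeps \<open>l < m\<close> strict even for integer
    \<open>l\<close>, as the strict distance condition in the modulus requires.\<close>
  define m where "m = Suc (nat \<lfloor>l\<rfloor>)"
  have l: "l \<ge> 0"
    using d by (simp add: l_def)
  have "l < real m"
    using l unfolding m_def by linarith
  then have "\<bar>f t - f s\<bar> \<le> real m * modulus_cont f \<delta>"
    using d by (intro modulus_cont_chain[OF f s t]) (auto simp: m_def l_def field_simps)
  \<comment> \<open>Below 1 the floor is 0; from 1 on, \<open>l \<le> l^2\<close>.\<close>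
  also have "real m \<le> 1 + l\<^sup>2"
  proof (cases "l < 1")
    case True
    then have "\<lfloor>l\<rfloor> = 0"
      using l by linarith
    then show ?thesis
      by (simp add: m_def)
  next
    case False
    then have "l \<le> l\<^sup>2"
      by (simp add: power2_eq_square)
    moreover have "real m \<le> 1 + l"
      using l by (simp add: m_def)
    ultimately show ?thesis
      by linarith
  qed
  also have "l\<^sup>2 = (t - s)\<^sup>2 / \<delta>\<^sup>2"
    by (simp add: l_def power_divide)
  finally show ?thesis
    using modulus_cont_nonneg[OF f d] by (simp add: mult_right_mono)
qed

text \<open>Averaging the quadratic bound: total mass and variance over \<open>\<delta>^2\<close>
  each contribute at most one modulus.\<close>

lemma weighted_mean_modulus_bound:
  fixes w t :: "'a \<Rightarrow> real"
  assumes f: "continuous_on {0..1} f" and x: "x \<in> {0..1}" and d: "\<delta> > 0"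
    and t: "\<And>k. k \<in> K \<Longrightarrow> t k \<in> {0..1}" and w: "\<And>k. k \<in> K \<Longrightarrow> w k \<ge> 0"
    and sum1: "(\<Sum>k\<in>K. w k) = 1" and var: "(\<Sum>k\<in>K. (t k - x)\<^sup>2 * w k) \<le> \<delta>\<^sup>2"
  shows "\<bar>(\<Sum>k\<in>K. f (t k) * w k) - f x\<bar> \<le> 2 * modulus_cont f \<delta>"
proof -
  let ?M = "modulus_cont f \<delta>"
  have "(\<Sum>k\<in>K. f (t k) * w k) - f x = (\<Sum>k\<in>K. (f (t k) - f x) * w k)"
    using sum1 by (simp add: left_diff_distrib sum_subtractf flip: sum_distrib_left)
  also have "\<bar>\<dots>\<bar> \<le> (\<Sum>k\<in>K. (1 + (t k - x)\<^sup>2 / \<delta>\<^sup>2) * ?M * w k)"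
  proof (rule order_trans[OF sum_abs], intro sum_mono)
    fix k assume k: "k \<in> K"
    show "\<bar>(f (t k) - f x) * w k\<bar> \<le> (1 + (t k - x)\<^sup>2 / \<delta>\<^sup>2) * ?M * w k"
      unfolding abs_mult using w[OF k] modulus_cont_quadratic[OF f x t[OF k] d]
      by (simp add: mult_right_mono)
  qed
  also have "\<dots> = ?M * ((\<Sum>k\<in>K. w k) + (\<Sum>k\<in>K. (t k - x)\<^sup>2 * w k) / \<delta>\<^sup>2)"
    by (simp add: sum_distrib_left sum_divide_distrib algebra_simps flip: sum.distrib)
  also have "\<dots> \<le> ?M * (1 + 1)"
    using var d modulus_cont_nonneg[OF f d] unfolding sum1
    by (intro mult_left_mono add_left_mono) (auto simp: divide_simps)
  finally show ?thesis
    by simp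
qed

section \<open>The error estimate\<close>

lemma king_lupas_error:
  assumes pq: "0 < q" "q < p" "p \<le> 1" and n: "n \<ge> 2"
    and h: "p * q * (pq_int p q n - 1) > p ^ n * (p - q)"
    and f: "continuous_on {0..1} f" and x: "x \<in> {0..1}" and d: "king_delta p q n x > 0"
  shows "\<bar>king_lupas p q n f x - f x\<bar> \<le> 2 * modulus_cont f (king_delta p q n x)"
proof -
  obtain m where m: "n = Suc (Suc m)"
    using n by (metis Suc_le_D numeral_2_eq_2 Suc_le_mono)
  define r where "r = king_r p q n x"
  have "n \<ge> 1"
    using n by simp
  note r = king_r_properties[OF pq this h x, folded r_def]
  have p: "p > 0"
    using pq by simp
  define u where "u k = lupas_weight p q n k (1 - r) r" for k
  define t where "t = lupas_node p q n"
  define G where "G = (\<Prod>j<n. p ^ j * (1 - r) + q ^ j * r)"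
  define H where "H = p * (1 - r) + q * r"
  define P where "P = (\<Prod>j<m. p ^ Suc (Suc j) * (1 - r) + q ^ Suc (Suc j) * r)"
  have factor_pos: "p ^ j * (1 - r) + q ^ j * r > 0" for j
  \<comment> \<open>For \<open>r = 0\<close> the first summand is positive, otherwise the
    second.\<close>
  proof (cases "r = 0")
    case False
    then show ?thesis
      using r p pq by (intro add_nonneg_pos) auto
  qed (use p in auto)
  have P: "P > 0"
    unfolding P_def by (intro prod_pos) (use factor_pos in blast)
  have H: "H > 0"
    using factor_pos[of 1] by (simp add: H_def)
  \<comment> \<open>The factor for \<open>j = 0\<close> is \<open>(1 - r) + r = 1\<close>, and
    \<open>H\<close> is the one for \<open>j = 1\<close>.\<close>
  have G: "G = H * P"
    unfolding G_def H_def P_def m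
    by (simp add: prod.lessThan_Suc_shift del: prod.lessThan_Suc)
  have N: "pq_int p q n > 0"
    using p pq n by (intro pq_int_pos) auto
  have mom0: "(\<Sum>k\<le>n. u k) = G"
    unfolding u_def G_def by (rule sum_lupas_weight) (use p pq in auto)
  have mom1: "(\<Sum>k\<le>n. t k * u k) = r * G"
    using first_moment_lupas_weight[OF p pq(1), of "Suc m" "1 - r" r] unfolding t_def u_def G
    unfolding H_def P_def m
    by (simp add: prod.lessThan_Suc_shift del: prod.lessThan_Suc sum.atMost_Suc)
  have mom2: "(\<Sum>k\<le>n. (t k)\<^sup>2 * u k) \<le> x\<^sup>2 * G"
  proof -
    have "pq_int p q n * (\<Sum>k\<le>n. (t k)\<^sup>2 * u k)
        = (p ^ (n - 1) * r * H + q\<^sup>2 * pq_int p q (n - 1) * r\<^sup>2) * P"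
      using second_moment_lupas_weight[OF p pq(1), of m "1 - r" r]
      unfolding t_def u_def H_def P_def m
      by (simp add: power2_eq_square[of r] algebra_simps del: sum.atMost_Suc)
    also have "\<dots> \<le> (x\<^sup>2 * pq_int p q n * H) * P"
      using r(3) P by (intro mult_right_mono) (auto simp: H_def)
    also have "\<dots> = pq_int p q n * (x\<^sup>2 * G)"
      by (simp add: G)
    finally show ?thesis
      using N by simp
  qed
  have G_pos: "G > 0"
    using G H P by simp
  \<comment> \<open>Positivity of \<open>king_delta\<close> makes its radicand positive, so squaring
    cancels the root.\<close>
  have delta: "(king_delta p q n x)\<^sup>2 = 2 * x\<^sup>2 - x * r"
    using d unfolding king_delta_eq r_def by simp
  have "\<bar>(\<Sum>k\<le>n. f (t k) * (u k / G)) - f x\<bar> \<le> 2 * modulus_cont f (king_delta p q n x)"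
  proof (rule weighted_mean_modulus_bound[OF f x d])
    fix k assume "k \<in> {..n}"
    then show "t k \<in> {0..1}"
      using lupas_node_bounds[OF p pq(1), of k "Suc m"] by (simp add: t_def m)
    show "u k / G \<ge> 0"
      unfolding u_def using lupas_weight_nonneg[OF p pq(1)] r G_pos by simp
  next
    show "(\<Sum>k\<le>n. u k / G) = 1"
      using mom0 G_pos by (simp flip: sum_divide_distrib)
  next
    have "(\<Sum>k\<le>n. (t k - x)\<^sup>2 * (u k / G))
        = (\<Sum>k\<le>n. (t k)\<^sup>2 * u k - 2 * x * (t k * u k) + x\<^sup>2 * u k) / G"
      unfolding sum_divide_distrib
      by (intro sum.cong refl) (simp add: power2_eq_square algebra_simps add_divide_distrib
          diff_divide_distrib)
    also have "\<dots> = ((\<Sum>k\<le>n. (t k)\<^sup>2 * u k) - 2 * x * (\<Sum>k\<le>n. t k * u k)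
        + x\<^sup>2 * (\<Sum>k\<le>n. u k)) / G"
      by (simp only: sum.distrib sum_subtractf sum_distrib_left)
    also have "\<dots> \<le> (x\<^sup>2 * G - 2 * x * (r * G) + x\<^sup>2 * G) / G"
      unfolding mom0 mom1 using mom2 G_pos by (intro divide_right_mono) linarith+
    also have "\<dots> = 2 * x\<^sup>2 - 2 * (x * r)"
      using G_pos by (simp add: field_simps)
    \<comment> \<open>One of the two copies of \<open>x * r \<ge> 0\<close> is given away.\<close>
    also have "\<dots> \<le> (king_delta p q n x)\<^sup>2"
      unfolding delta using x r by simp
    finally show "(\<Sum>k\<le>n. (t k - x)\<^sup>2 * (u k / G)) \<le> (king_delta p q n x)\<^sup>2" .
  qed
  also have "(\<Sum>k\<le>n. f (t k) * (u k / G)) = king_lupas p q n f x"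
    unfolding king_lupas_def t_def u_def lupas_weight_def lupas_node_def G_def
    by (simp add: mult_ac flip: r_def)
  finally show ?thesis .
qed

theorem theorem3p1:
  fixes p q :: "nat \<Rightarrow> real" and a :: real
  assumes "\<And>n. n \<ge> 2 \<Longrightarrow> q n \<in> {0<..<1}"
    and "\<And>n. n \<ge> 2 \<Longrightarrow> p n \<in> {q n<..1}"
    and "p \<longlonglongrightarrow> a"
    and "q \<longlonglongrightarrow> 1"
    and "(\<lambda>n. p n ^ n) \<longlonglongrightarrow> 1"
    and "(\<lambda>n. q n ^ n) \<longlonglongrightarrow> 1"
    and "\<And>n. n \<ge> 2 \<Longrightarrow>
           p n * q n * (pq_int (p n) (q n) n - 1) > p n ^ n * (p n - q n)"
  shows "\<forall>n\<ge>2. \<forall>f. continuous_on {0..1} f \<longrightarrow>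
           (\<forall>x\<in>{0..1}. king_delta (p n) (q n) n x > 0 \<longrightarrow>
              \<bar>king_lupas (p n) (q n) n f x - f x\<bar>
                \<le> 2 * modulus_cont f (king_delta (p n) (q n) n x))"
  using assms(1,2,7) by (auto intro!: king_lupas_error)

end
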